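(* Let $N\ge 2$, let $C\in M_N(\mathbb{R})$, and let $f:[0,1]\to\mathbb{R}$ be strictly convex and continuous with $f\in C^1((0,1])$. Let $x,y\in\mathcal{P}_N$ and $\lambda\in[0,\Lambda(x,y)]$. Then $$\mathcal{C}_\lambda(x,y)=\inf\{\langle C,\Pi\rangle \mid \Pi\in\Pi(x,y),\ \mathcal{D}_f(\Pi,x\otimes y)=\lambda\}.$$ Furthermore, if $\lambda=\mathcal{D}_f(P^\gamma,x\otimes y)$ for some $\gamma\ge 0$, where $P^\gamma$ is an $(f,\gamma)$-coupling between $x,y$, then $\mathcal{C}_\lambda(x,y)=\mathcal{C}^\gamma(x,y)$.
   Context: $\mathcal{P}_N=\{x\in\mathbb{R}^N: x_i\ge 0,\ \sum_i x_i=1\}$. For $x,y\in\mathcal{P}_N$, $\Pi(x,y)$ is the set of couplings: matrices $\Pi=(\pi_{ij})\in M_N(\mathbb{R})$ with $\pi_{ij}\ge 0$, $\sum_k\pi_{ik}=x_i$, $\sum_k\pi_{kj}=y_j$ for all $i,j$. $(x\otimes y)_{ij}=x_iy_j$. $\langle C,\Pi\rangle=\sum_{i,j}c_{ij}\pi_{ij}$. $\mathcal{C}(x,y)=\inf_{\Pi\in\Pi(x,y)}\langle C,\Pi\rangle$, and a coupling attaining this infimum is called optimal. Bregman divergence: $f'(0):=\lim_{\varepsilon\downarrow 0}f'(\varepsilon)\in[-\infty,\infty)$, with the convention $\pm\infty\cdot 0=0$; $D_f(r,r_0)=f(r)-f(r_0)-f'(r_0)(r-r_0)$ for $r,r_0\in[0,1]$,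 and $\mathcal{D}_f(\Pi,\widetilde\Pi)=\sum_{i,j=1}^N D_f(\pi_{ij},\widetilde\pi_{ij})$. (For $\Pi\in\Pi(x,y)$, the entries with $x_iy_j=0$ contribute $0$ to $\mathcal{D}_f(\Pi,x\otimes y)$, which is finite and nonnegative.) For $\gamma\ge 0$, $\mathcal{F}^\gamma_{x,y}(\Pi)=\langle C,\Pi\rangle+\gamma\mathcal{D}_f(\Pi,x\otimes y)$ on $\Pi(x,y)$; an $(f,\gamma)$-coupling between $x,y$ is a minimizer of $\mathcal{F}^\gamma_{x,y}$ over $\Pi(x,y)$. $\mathcal{C}^\gamma(x,y)=\inf\{\langle C,P^\gamma\rangle\mid P^\gamma\in\Pi(x,y)\text{ is an }(f,\gamma)\text{-coupling}\}$ for $\gamma\ge0$. $\mathcal{C}_\lambda(x,y)=\inf\{\langle C,\Pi\rangle\mid \Pi\in\Pi(x,y),\ \mathcal{D}_f(\Pi,x\otimes y)\le\lambda\}$ for $\lambda\ge 0$. $\Lambda(x,y)=\inf\{\mathcal{D}_f(\Pi,x\otimes y)\mid \Pi\in\Pi(x,y)\text{ is an optimal coupling}\}$. *)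

theory Defs
  imports "HOL-Analysis.Analysis"
begin

definition strictly_convex_on :: "real set \<Rightarrow> (real \<Rightarrow> real) \<Rightarrow> bool" where
  "strictly_convex_on S f \<longleftrightarrow>
     convex S \<and>
     (\<forall>u\<in>S. \<forall>v\<in>S. \<forall>t. u \<noteq> v \<longrightarrow> 0 < t \<longrightarrow> t < 1 \<longrightarrow>
        f ((1 - t) * u + t * v) < (1 - t) * f u + t * f v)"

text \<open>
  A function \<open>f : [0,1] \<rightarrow> \<real>\<close> is represented by a total function of which only the values on
  \<open>{0..1}\<close> are used.  Hence all derivatives are taken within \<open>{0..1}\<close>: two-sided at
  interior points, one-sided at \<open>1\<close>.
\<close>

definition C1_half_open :: "(real \<Rightarrow> real) \<Rightarrow> bool" where
  "C1_half_open f \<longleftrightarrow>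
     (\<exists>f'. (\<forall>r\<in>{0<..1}. (f has_real_derivative f' r) (at r within {0..1})) \<and>
           continuous_on {0<..1} f')"

text \<open>
  The value at \<open>0\<close> is the limit of the derivative, taken in the extended reals, where it may be
  \<open>-\<infinity>\<close>.
\<close>

definition ext_deriv :: "(real \<Rightarrow> real) \<Rightarrow> real \<Rightarrow> ereal" where
  "ext_deriv f r =
     (if r = 0 then Lim (at_right 0) (\<lambda>e. ereal (vector_derivative f (at e within {0..1})))
      else ereal (vector_derivative f (at r within {0..1})))"

text \<open>
  Multiplication of extended reals satisfies \<open>\<plusminus>\<infinity> * 0 = 0\<close>, as the convention for the Bregman
  divergence requires.  The divergence is \<open>\<infinity>\<close> when \<open>r\<^sub>0 = 0 < r\<close> and the derivative at \<open>0\<close>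
  is \<open>-\<infinity>\<close>.
\<close>

definition bregman :: "(real \<Rightarrow> real) \<Rightarrow> real \<Rightarrow> real \<Rightarrow> ereal" where
  "bregman f r r\<^sub>0 = ereal (f r) - ereal (f r\<^sub>0) - ext_deriv f r\<^sub>0 * ereal (r - r\<^sub>0)"

definition bregman_mat ::
  "(real \<Rightarrow> real) \<Rightarrow> real ^ 'n ^ 'n \<Rightarrow> real ^ 'n ^ 'n \<Rightarrow> ereal" where
  "bregman_mat f P Q = (\<Sum>i\<in>UNIV. \<Sum>j\<in>UNIV. bregman f (P $ i $ j) (Q $ i $ j))"

definition prob_vectors :: "(real ^ 'n) set" where
  "prob_vectors = {x. (\<forall>i. x $ i \<ge> 0) \<and> (\<Sum>i\<in>UNIV. x $ i) = 1}"

definition couplings :: "real ^ 'n \<Rightarrow> real ^ 'n \<Rightarrow> (real ^ 'n ^ 'n) set" where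
  "couplings x y =
     {P. (\<forall>i j. P $ i $ j \<ge> 0) \<and>
         (\<forall>i. (\<Sum>k\<in>UNIV. P $ i $ k) = x $ i) \<and>
         (\<forall>j. (\<Sum>k\<in>UNIV. P $ k $ j) = y $ j)}"

definition tensor :: "real ^ 'n \<Rightarrow> real ^ 'n \<Rightarrow> real ^ 'n ^ 'n" where
  "tensor x y = (\<chi> i j. x $ i * y $ j)"

definition cost :: "real ^ 'n ^ 'n \<Rightarrow> real ^ 'n ^ 'n \<Rightarrow> real" where
  "cost C P = (\<Sum>i\<in>UNIV. \<Sum>j\<in>UNIV. C $ i $ j * P $ i $ j)"

text \<open>
  All infima are taken in the extended reals, so that the infimum over the empty set is \<open>\<infinity>\<close>.
\<close>

definition opt_cost :: "real ^ 'n ^ 'n \<Rightarrow> real ^ 'n \<Rightarrow> real ^ 'n \<Rightarrow> ereal" where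
  "opt_cost C x y = (INF P\<in>couplings x y. ereal (cost C P))"

definition optimal_coupling ::
  "real ^ 'n ^ 'n \<Rightarrow> real ^ 'n \<Rightarrow> real ^ 'n \<Rightarrow> real ^ 'n ^ 'n \<Rightarrow> bool" where
  "optimal_coupling C x y P \<longleftrightarrow> P \<in> couplings x y \<and> ereal (cost C P) = opt_cost C x y"

definition reg_cost ::
  "(real \<Rightarrow> real) \<Rightarrow> real ^ 'n ^ 'n \<Rightarrow> real \<Rightarrow> real ^ 'n \<Rightarrow> real ^ 'n \<Rightarrow> real ^ 'n ^ 'n \<Rightarrow> ereal" where
  "reg_cost f C \<gamma> x y P = ereal (cost C P) + ereal \<gamma> * bregman_mat f P (tensor x y)"

definition reg_coupling ::
  "(real \<Rightarrow> real) \<Rightarrow> real ^ 'n ^ 'n \<Rightarrow> real \<Rightarrow> real ^ 'n \<Rightarrow> real ^ 'n \<Rightarrow> real ^ 'n ^ 'n \<Rightarrow> bool" where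
  "reg_coupling f C \<gamma> x y P \<longleftrightarrow>
     P \<in> couplings x y \<and> (\<forall>Q\<in>couplings x y. reg_cost f C \<gamma> x y P \<le> reg_cost f C \<gamma> x y Q)"

definition reg_opt_cost ::
  "(real \<Rightarrow> real) \<Rightarrow> real ^ 'n ^ 'n \<Rightarrow> real \<Rightarrow> real ^ 'n \<Rightarrow> real ^ 'n \<Rightarrow> ereal" where
  "reg_opt_cost f C \<gamma> x y = (INF P\<in>{P. reg_coupling f C \<gamma> x y P}. ereal (cost C P))"

definition constr_opt_cost ::
  "(real \<Rightarrow> real) \<Rightarrow> real ^ 'n ^ 'n \<Rightarrow> real \<Rightarrow> real ^ 'n \<Rightarrow> real ^ 'n \<Rightarrow> ereal" where
  "constr_opt_cost f C l x y =
     (INF P\<in>{P \<in> couplings x y. bregman_mat f P (tensor x y) \<le> ereal l}. ereal (cost C P))"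

definition max_constr ::
  "(real \<Rightarrow> real) \<Rightarrow> real ^ 'n ^ 'n \<Rightarrow> real ^ 'n \<Rightarrow> real ^ 'n \<Rightarrow> ereal" where
  "max_constr f C x y = (INF P\<in>{P. optimal_coupling C x y P}. bregman_mat f P (tensor x y))"

end

theory Submission
  imports Defs
begin

text \<open>
  Two facts about the set of couplings carry the proof: it is compact and convex, and on it the
  divergence from \<open>x \<otimes> y\<close> is a finite, continuous and strictly convex function of the coupling
  (it is \<open>\<Sum> f(\<pi>\<^sub>i\<^sub>j)\<close> plus an affine function).

  For the first claim, move a coupling \<open>P\<close> of divergence at most \<open>l\<close> along the segment towards an
  optimal coupling \<open>Q\<close>.  The divergence of \<open>Q\<close> is at least \<open>\<Lambda>(x,y) \<ge> l\<close>, so by the intermediate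
  value theorem it equals \<open>l\<close> somewhere on the segment; and the cost, being affine and minimal at
  \<open>Q\<close>, has not increased on the way.  Hence the points of divergence exactly \<open>l\<close> give the same
  infimum.

  For the second claim, let \<open>P\<close> be a regularised coupling of divergence \<open>l\<close>.  A coupling of
  divergence at most \<open>l\<close> that was cheaper than \<open>P\<close> would also have a smaller regularised cost;
  therefore \<open>P\<close> solves the constrained problem.  All \<open>(f,\<gamma>)\<close>-couplings have the cost of \<open>P\<close>: for
  \<open>\<gamma> = 0\<close> they minimise the cost itself, and for \<open>\<gamma> > 0\<close> strict convexity makes \<open>P\<close> the only one.
\<close>

section \<open>The polytope of couplings\<close>

lemma coupling_entry_le_marginals:
  assumes "P \<in> couplings x y"
  shows "P $ i $ j \<le> x $ i" "P $ i $ j \<le> y $ j"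
proof -
  have nn: "P $ i $ j \<ge> 0" for i j
    using assms by (simp add: couplings_def)
  have row: "(\<Sum>k\<in>UNIV. P $ i $ k) = x $ i"
    and col: "(\<Sum>k\<in>UNIV. P $ k $ j) = y $ j"
    using assms by (auto simp: couplings_def)
  show "P $ i $ j \<le> x $ i"
    unfolding row[symmetric] by (rule member_le_sum) (auto simp: nn)
  show "P $ i $ j \<le> y $ j"
    unfolding col[symmetric] by (rule member_le_sum[where f = "\<lambda>k. P $ k $ j"]) (auto simp: nn)
qed

lemma coupling_entry_in_unit:
  assumes "x \<in> prob_vectors" and "P \<in> couplings x y"
  shows "P $ i $ j \<in> {0..1}"
proof -
  have "x $ i \<le> (\<Sum>i\<in>UNIV. x $ i)"
    using assms(1) by (intro member_le_sum) (auto simp: prob_vectors_def)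
  then have "x $ i \<le> 1" using assms(1) by (simp add: prob_vectors_def)
  then show ?thesis
    using coupling_entry_le_marginals(1)[OF assms(2), of i j] assms(2)
    by (auto simp: couplings_def)
qed

lemma tensor_in_couplings:
  assumes "x \<in> prob_vectors" and "y \<in> prob_vectors"
  shows "tensor x y \<in> couplings x y"
  using assms
  by (auto simp: couplings_def tensor_def prob_vectors_def
      simp flip: sum_distrib_left sum_distrib_right)

lemma convex_couplings: "convex (couplings x y)"
  unfolding convex_def couplings_def
  by (auto simp: sum.distrib simp flip: sum_distrib_left distrib_right)

lemma compact_couplings:
  assumes "x \<in> prob_vectors"
  shows "compact (couplings x y)"
proof -
  have "norm P \<le> 1" if P: "P \<in> couplings x y" for P
  proof -
    have "norm P \<le> (\<Sum>i\<in>UNIV. norm (P $ i))"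
      unfolding norm_vec_def by (rule L2_set_le_sum) auto
    also have "\<dots> \<le> (\<Sum>i\<in>UNIV. \<Sum>j\<in>UNIV. \<bar>P $ i $ j\<bar>)"
      by (intro sum_mono norm_le_l1_cart)
    also have "\<dots> = 1"
      using P assms by (simp add: couplings_def prob_vectors_def)
    finally show ?thesis .
  qed
  then have "bounded (couplings x y)" unfolding bounded_iff by blast
  moreover have "closed (couplings x y)"
    unfolding couplings_def
    by (intro closed_Collect_conj closed_Collect_all closed_Collect_le closed_Collect_eq
        continuous_intros)
  ultimately show ?thesis using compact_eq_bounded_closed by blast
qed

section \<open>The transport cost\<close>

lemma continuous_on_cost: "continuous_on S (cost C)"
  unfolding cost_def by (intro continuous_intros)

lemma cost_convex_combination:
  "cost C ((1 - t) *\<^sub>R P + t *\<^sub>R Q) = (1 - t) * cost C P + t * cost C Q"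
  unfolding cost_def sum_distrib_left sum.distrib[symmetric]
  by (intro sum.cong refl) (simp add: algebra_simps)

lemma optimal_coupling_iff:
  "optimal_coupling C x y Q \<longleftrightarrow>
     Q \<in> couplings x y \<and> (\<forall>P\<in>couplings x y. cost C Q \<le> cost C P)"
  (is "?L \<longleftrightarrow> ?R")
proof
  assume ?L
  then have Q: "Q \<in> couplings x y" "ereal (cost C Q) = opt_cost C x y"
    by (auto simp: optimal_coupling_def)
  have "opt_cost C x y \<le> ereal (cost C P)" if "P \<in> couplings x y" for P
    unfolding opt_cost_def using that by (rule INF_lower)
  with Q show ?R by (metis ereal_less_eq(3))
next
  assume ?R
  then show ?L
    unfolding optimal_coupling_def opt_cost_def
    by (auto intro!: antisym INF_greatest INF_lower)
qed

lemma optimal_coupling_exists: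
  assumes "x \<in> prob_vectors" and "y \<in> prob_vectors"
  obtains Q where "optimal_coupling C x y Q"
proof -
  have "\<exists>Q\<in>couplings x y. \<forall>P\<in>couplings x y. cost C Q \<le> cost C P"
    using tensor_in_couplings[OF assms]
    by (intro continuous_attains_inf compact_couplings assms continuous_on_cost) auto
  with that show thesis by (auto simp: optimal_coupling_iff)
qed

section \<open>The divergence from the product coupling\<close>

text \<open>
  The slope at \<open>0\<close> is replaced by the arbitrary real value \<open>0\<close>.  On couplings this changes nothing:
  an entry of \<open>x \<otimes> y\<close> vanishes only if the corresponding entry of every coupling does, and there
  the slope is multiplied by \<open>0\<close>.
\<close>

definition fin_bregman :: "(real \<Rightarrow> real) \<Rightarrow> real \<Rightarrow> real \<Rightarrow> real" where
  "fin_bregman f r q =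
     f r - f q - (if q = 0 then 0 else vector_derivative f (at q within {0..1})) * (r - q)"

definition fin_bregman_mat ::
  "(real \<Rightarrow> real) \<Rightarrow> real ^ 'n ^ 'n \<Rightarrow> real ^ 'n ^ 'n \<Rightarrow> real" where
  "fin_bregman_mat f P Q = (\<Sum>i\<in>UNIV. \<Sum>j\<in>UNIV. fin_bregman f (P $ i $ j) (Q $ i $ j))"

lemma bregman_mat_coupling:
  assumes "P \<in> couplings x y"
  shows "bregman_mat f P (tensor x y) = ereal (fin_bregman_mat f P (tensor x y))"
proof -
  have "bregman f (P $ i $ j) (tensor x y $ i $ j)
      = ereal (fin_bregman f (P $ i $ j) (tensor x y $ i $ j))" for i j
  proof (cases "tensor x y $ i $ j = 0")
    case True
    then have "P $ i $ j \<le> 0"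
      using coupling_entry_le_marginals[OF assms, of i j] by (auto simp: tensor_def)
    moreover have "P $ i $ j \<ge> 0" using assms by (simp add: couplings_def)
    ultimately have "P $ i $ j = 0" by simp
    with True show ?thesis by (simp add: bregman_def fin_bregman_def zero_ereal_def[symmetric])
  next
    case False
    then show ?thesis by (simp add: bregman_def fin_bregman_def ext_deriv_def)
  qed
  then show ?thesis by (simp add: bregman_mat_def fin_bregman_mat_def)
qed

lemma continuous_on_fin_bregman_mat:
  assumes "continuous_on {0..1} f" and "x \<in> prob_vectors"
  shows "continuous_on (couplings x y) (\<lambda>P. fin_bregman_mat f P R)"
proof -
  have "continuous_on (couplings x y) (\<lambda>P. f (P $ i $ j))" for i j
    by (rule continuous_on_compose2[OF assms(1)])
      (auto intro!: continuous_intros simp: coupling_entry_in_unit[OF assms(2), simplified])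
  then show ?thesis
    unfolding fin_bregman_mat_def fin_bregman_def by (intro continuous_intros)
qed

lemma fin_bregman_strictly_convex:
  assumes "strictly_convex_on {0..1} f"
    and "u \<in> {0..1}" "v \<in> {0..1}" "u \<noteq> v" "0 < t" "t < 1"
  shows "fin_bregman f ((1 - t) * u + t * v) q
           < (1 - t) * fin_bregman f u q + t * fin_bregman f v q"
proof -
  have "f ((1 - t) * u + t * v) < (1 - t) * f u + t * f v"
    using assms by (auto simp: strictly_convex_on_def)
  then show ?thesis by (simp add: fin_bregman_def algebra_simps)
qed

lemma fin_bregman_mat_strictly_convex:
  assumes sc: "strictly_convex_on {0..1} f" and x: "x \<in> prob_vectors"
    and P: "P \<in> couplings x y" and Q: "Q \<in> couplings x y" and "P \<noteq> Q"
    and t: "0 < t" "t < 1"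
  shows "fin_bregman_mat f ((1 - t) *\<^sub>R P + t *\<^sub>R Q) R
           < (1 - t) * fin_bregman_mat f P R + t * fin_bregman_mat f Q R"
proof -
  let ?l = "\<lambda>i j. fin_bregman f ((1 - t) * P $ i $ j + t * Q $ i $ j) (R $ i $ j)"
  let ?r = "\<lambda>i j. (1 - t) * fin_bregman f (P $ i $ j) (R $ i $ j)
                  + t * fin_bregman f (Q $ i $ j) (R $ i $ j)"
  have less: "?l i j < ?r i j" if "P $ i $ j \<noteq> Q $ i $ j" for i j
    using that t by (intro fin_bregman_strictly_convex sc coupling_entry_in_unit[OF x P] coupling_entry_in_unit[OF x Q])
  have le: "?l i j \<le> ?r i j" for i j
  proof (cases "P $ i $ j = Q $ i $ j")
    case True
    then show ?thesis by (simp add: algebra_simps)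
  qed (use less in \<open>simp add: less_imp_le\<close>)
  obtain i j where ij: "P $ i $ j \<noteq> Q $ i $ j"
    using \<open>P \<noteq> Q\<close> by (auto simp: vec_eq_iff)
  have "(\<Sum>j\<in>UNIV. ?l i j) < (\<Sum>j\<in>UNIV. ?r i j)"
    using le less[OF ij] by (intro sum_strict_mono_ex1) auto
  then have "(\<Sum>i\<in>UNIV. \<Sum>j\<in>UNIV. ?l i j) < (\<Sum>i\<in>UNIV. \<Sum>j\<in>UNIV. ?r i j)"
    by (intro sum_strict_mono_ex1) (auto intro!: sum_mono le)
  then show ?thesis
    by (simp add: fin_bregman_mat_def sum_distrib_left sum.distrib)
qed

section \<open>Exhausting the divergence budget\<close>

text \<open>
  The coupling \<open>R\<close> is found on the segment from \<open>P\<close> to an optimal coupling, along which the cost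
  does not increase and the divergence ends up at \<open>\<Lambda>(x,y)\<close> or above.
\<close>

lemma exists_cheaper_coupling_of_divergence:
  assumes cont: "continuous_on {0..1} f"
    and x: "x \<in> prob_vectors" and y: "y \<in> prob_vectors"
    and l: "ereal l \<le> max_constr f C x y"
    and P: "P \<in> couplings x y" and Pl: "bregman_mat f P (tensor x y) \<le> ereal l"
  obtains R where "R \<in> couplings x y" "bregman_mat f R (tensor x y) = ereal l"
    "cost C R \<le> cost C P"
proof -
  let ?D = "\<lambda>P. fin_bregman_mat f P (tensor x y)"
  obtain Q where Qopt: "optimal_coupling C x y Q"
    using optimal_coupling_exists[OF x y] .
  then have Q: "Q \<in> couplings x y" and QP: "cost C Q \<le> cost C P"
    using P by (auto simp: optimal_coupling_iff)
  have "max_constr f C x y \<le> bregman_mat f Q (tensor x y)"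
    unfolding max_constr_def using Qopt by (intro INF_lower) simp
  with l have DQ: "l \<le> ?D Q"
    unfolding bregman_mat_coupling[OF Q] by (metis ereal_less_eq(3) order_trans)
  have DP: "?D P \<le> l" using Pl by (simp add: bregman_mat_coupling[OF P])
  define S where "S t = (1 - t) *\<^sub>R P + t *\<^sub>R Q" for t :: real
  have S: "S t \<in> couplings x y" if "t \<in> {0..1}" for t
    using that convexD_alt[OF convex_couplings P Q, of t] by (simp add: S_def)
  have "continuous_on {0..1} S"
    unfolding S_def by (intro continuous_intros)
  then have "continuous_on {0..1} (\<lambda>t. ?D (S t))"
    by (rule continuous_on_compose2[OF continuous_on_fin_bregman_mat[OF cont x]]) (auto intro: S)
  then have "\<exists>t\<ge>0. t \<le> 1 \<and> ?D (S t) = l"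
    using DP DQ by (intro IVT') (simp_all add: S_def)
  then obtain t where t: "0 \<le> t" "t \<le> 1" and Dt: "?D (S t) = l" by blast
  have St: "S t \<in> couplings x y" using S t by simp
  show thesis
  proof (rule that[OF St])
    show "bregman_mat f (S t) (tensor x y) = ereal l"
      by (simp add: bregman_mat_coupling[OF St] Dt)
    have "cost C (S t) = cost C P - t * (cost C P - cost C Q)"
      unfolding S_def cost_convex_combination by (simp add: algebra_simps)
    also have "\<dots> \<le> cost C P" using t QP by simp
    finally show "cost C (S t) \<le> cost C P" .
  qed
qed

lemma constr_opt_cost_eq_INF_divergence:
  assumes "continuous_on {0..1} f"
    and "x \<in> prob_vectors" and "y \<in> prob_vectors"
    and "ereal l \<le> max_constr f C x y"
  shows "constr_opt_cost f C l x y =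
           (INF P\<in>{P \<in> couplings x y. bregman_mat f P (tensor x y) = ereal l}. ereal (cost C P))"
  unfolding constr_opt_cost_def
proof (rule antisym)
  show "(INF P\<in>{P \<in> couplings x y. bregman_mat f P (tensor x y) \<le> ereal l}. ereal (cost C P))
      \<le> (INF P\<in>{P \<in> couplings x y. bregman_mat f P (tensor x y) = ereal l}. ereal (cost C P))"
    by (rule INF_superset_mono) auto
next
  show "(INF P\<in>{P \<in> couplings x y. bregman_mat f P (tensor x y) = ereal l}. ereal (cost C P))
      \<le> (INF P\<in>{P \<in> couplings x y. bregman_mat f P (tensor x y) \<le> ereal l}. ereal (cost C P))"
  proof (rule INF_mono)
    fix P assume "P \<in> {P \<in> couplings x y. bregman_mat f P (tensor x y) \<le> ereal l}"
    then obtain R where "R \<in> couplings x y" "bregman_mat f R (tensor x y) = ereal l"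
      "cost C R \<le> cost C P"
      using exists_cheaper_coupling_of_divergence[OF assms] by blast
    then show "\<exists>R\<in>{P \<in> couplings x y. bregman_mat f P (tensor x y) = ereal l}.
        ereal (cost C R) \<le> ereal (cost C P)"
      by auto
  qed
qed

section \<open>Regularised couplings\<close>

lemma reg_coupling_iff:
  "reg_coupling f C \<gamma> x y P \<longleftrightarrow>
     P \<in> couplings x y \<and>
     (\<forall>Q\<in>couplings x y. cost C P + \<gamma> * fin_bregman_mat f P (tensor x y)
                       \<le> cost C Q + \<gamma> * fin_bregman_mat f Q (tensor x y))"
  by (auto simp: reg_coupling_def reg_cost_def bregman_mat_coupling)

lemma reg_coupling_unique:
  assumes sc: "strictly_convex_on {0..1} f" and x: "x \<in> prob_vectors" and "\<gamma> > 0"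
    and "reg_coupling f C \<gamma> x y P" and "reg_coupling f C \<gamma> x y Q"
  shows "P = Q"
proof (rule ccontr)
  assume "P \<noteq> Q"
  let ?F = "\<lambda>P. cost C P + \<gamma> * fin_bregman_mat f P (tensor x y)"
  \<comment> \<open>the midpoint of two distinct minimisers would have a smaller value\<close>
  define M where "M = (1 - 1/2) *\<^sub>R P + (1/2 :: real) *\<^sub>R Q"
  have P: "P \<in> couplings x y" and Q: "Q \<in> couplings x y"
    using assms by (auto simp: reg_coupling_iff)
  have M: "M \<in> couplings x y"
    unfolding M_def by (rule convexD_alt[OF convex_couplings P Q]) auto
  have "fin_bregman_mat f M (tensor x y)
      < (1 - 1/2) * fin_bregman_mat f P (tensor x y) + 1/2 * fin_bregman_mat f Q (tensor x y)"
    unfolding M_def by (rule fin_bregman_mat_strictly_convex[OF sc x P Q \<open>P \<noteq> Q\<close>]) auto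
  from mult_strict_left_mono[OF this \<open>\<gamma> > 0\<close>]
  have "2 * ?F M < ?F P + ?F Q"
    unfolding M_def cost_convex_combination by (simp add: algebra_simps)
  moreover have "?F P \<le> ?F M" "?F Q \<le> ?F M"
    using assms M by (auto simp: reg_coupling_iff)
  ultimately show False using add_mono[of "?F P" "?F M" "?F Q" "?F M"] by simp
qed

lemma reg_coupling_cost_unique:
  assumes "strictly_convex_on {0..1} f" and "x \<in> prob_vectors" and "\<gamma> \<ge> 0"
    and P: "reg_coupling f C \<gamma> x y P" and Q: "reg_coupling f C \<gamma> x y Q"
  shows "cost C P = cost C Q"
proof (cases "\<gamma> = 0")
  case True
  then show ?thesis using P Q by (force simp: reg_coupling_iff)
next
  case False
  then show ?thesis using reg_coupling_unique[OF assms(1,2) _ P Q] assms(3) by simp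
qed

lemma reg_opt_cost_eq_cost:
  assumes "strictly_convex_on {0..1} f" and "x \<in> prob_vectors" and "\<gamma> \<ge> 0"
    and P: "reg_coupling f C \<gamma> x y P"
  shows "reg_opt_cost f C \<gamma> x y = ereal (cost C P)"
  unfolding reg_opt_cost_def
proof (rule antisym)
  show "(INF P\<in>{P. reg_coupling f C \<gamma> x y P}. ereal (cost C P)) \<le> ereal (cost C P)"
    using P by (intro INF_lower) simp
  show "ereal (cost C P) \<le> (INF P\<in>{P. reg_coupling f C \<gamma> x y P}. ereal (cost C P))"
    using reg_coupling_cost_unique[OF assms] by (intro INF_greatest) simp
qed

text \<open>
  Here \<open>\<gamma>\<close> acts as a Lagrange multiplier: among the couplings of divergence at most \<open>l\<close>, none can
  beat \<open>P\<close> in cost, because its penalty is at most that of \<open>P\<close> while \<open>P\<close> minimises cost plus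
  penalty.
\<close>

lemma constr_opt_cost_eq_cost_reg_coupling:
  assumes "\<gamma> \<ge> 0" and P: "reg_coupling f C \<gamma> x y P"
    and l: "ereal l = bregman_mat f P (tensor x y)"
  shows "constr_opt_cost f C l x y = ereal (cost C P)"
  unfolding constr_opt_cost_def
proof (rule antisym)
  have Pc: "P \<in> couplings x y" using P by (simp add: reg_coupling_iff)
  show "(INF P\<in>{P \<in> couplings x y. bregman_mat f P (tensor x y) \<le> ereal l}. ereal (cost C P))
      \<le> ereal (cost C P)"
    using Pc l by (intro INF_lower) simp
  show "ereal (cost C P)
      \<le> (INF P\<in>{P \<in> couplings x y. bregman_mat f P (tensor x y) \<le> ereal l}. ereal (cost C P))"
  proof (rule INF_greatest)
    fix Q assume "Q \<in> {P \<in> couplings x y. bregman_mat f P (tensor x y) \<le> ereal l}"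
    then have Q: "Q \<in> couplings x y"
      and "fin_bregman_mat f Q (tensor x y) \<le> fin_bregman_mat f P (tensor x y)"
      using l by (auto simp: bregman_mat_coupling Pc)
    then have "\<gamma> * fin_bregman_mat f Q (tensor x y) \<le> \<gamma> * fin_bregman_mat f P (tensor x y)"
      using \<open>\<gamma> \<ge> 0\<close> by (intro mult_left_mono)
    moreover have "cost C P + \<gamma> * fin_bregman_mat f P (tensor x y)
        \<le> cost C Q + \<gamma> * fin_bregman_mat f Q (tensor x y)"
      using P Q by (simp add: reg_coupling_iff)
    ultimately show "ereal (cost C P) \<le> ereal (cost C Q)" by simp
  qed
qed

theorem theorem3p4:
  fixes C :: "real ^ 'n ^ 'n" and f :: "real \<Rightarrow> real"
    and x y :: "real ^ 'n" and l :: real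
  assumes "CARD('n) \<ge> 2"
    and "strictly_convex_on {0..1} f"
    and "continuous_on {0..1} f"
    and "C1_half_open f"
    and "x \<in> prob_vectors" and "y \<in> prob_vectors"
    and "0 \<le> l" and "ereal l \<le> max_constr f C x y"
  shows "constr_opt_cost f C l x y =
           (INF P\<in>{P \<in> couplings x y. bregman_mat f P (tensor x y) = ereal l}. ereal (cost C P))
       \<and> (\<forall>\<gamma> P. \<gamma> \<ge> 0 \<longrightarrow> reg_coupling f C \<gamma> x y P \<longrightarrow> ereal l = bregman_mat f P (tensor x y) \<longrightarrow>
            constr_opt_cost f C l x y = reg_opt_cost f C \<gamma> x y)"
  using constr_opt_cost_eq_INF_divergence[OF assms(3,5,6,8)]
    constr_opt_cost_eq_cost_reg_coupling reg_opt_cost_eq_cost[OF assms(2,5)]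
  by metis

end
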